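(* Every locally Gabriel graph on a set of $n$ points in the plane in convex position has at most $2n\log n+O(n)$ edges.
   Context: $\log$ denotes the binary logarithm. A geometric graph $G=(P,E)$ on a finite planar point set $P$ is a locally Gabriel graph if for every edge $(u,v)\in E$, the disk with diameter $\overline{uv}$ contains no neighbour in $G$ of $u$ or of $v$ (other than $u$ and $v$ themselves). Points are in convex position if each of them is a vertex of the convex hull of the set. *)

theory Defs
  imports "HOL-Analysis.Analysis"
begin

type_synonym point = "real^2"

definition geometric_graph :: "point set \<Rightarrow> point set set \<Rightarrow> bool" where
  "geometric_graph P E \<longleftrightarrow> E \<subseteq> {{u, v} | u v. u \<in> P \<and> v \<in> P \<and> u \<noteq> v}"

definition diam_disk :: "point \<Rightarrow> point \<Rightarrow> point set" where
  "diam_disk u v = cball (midpoint u v) (dist u v / 2)"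

definition locally_gabriel :: "point set \<Rightarrow> point set set \<Rightarrow> bool" where
  "locally_gabriel P E \<longleftrightarrow> geometric_graph P E \<and>
     (\<forall>u v. {u, v} \<in> E \<longrightarrow>
        (\<forall>w. ({u, w} \<in> E \<or> {v, w} \<in> E) \<longrightarrow> w \<noteq> u \<longrightarrow> w \<noteq> v \<longrightarrow>
             w \<notin> diam_disk u v))"

definition convex_position :: "point set \<Rightarrow> bool" where
  "convex_position P \<longleftrightarrow> (\<forall>p\<in>P. p \<notin> convex hull (P - {p}))"

end

theory Submission
  imports Defs
begin

text \<open>
  Two edges \<open>uv\<close>, \<open>uw\<close> of a locally Gabriel graph span a triangle whose angles at \<open>v\<close> and \<open>w\<close> are
  acute. After a rotation that makes the first coordinates distinct, the points form a convex lower
  and a concave upper chain, both ordered by first coordinate. Inside a chain every edge goes to the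
  leftmost left neighbour or to the rightmost right neighbour of one of its ends: otherwise two
  consecutive angles along the chain would be acute, against the monotonicity of the slopes.

  View the edges between the chains as a 0-1 matrix. If an edge \<open>ab\<close> is followed by an edge \<open>ay\<close> in
  its row and by \<open>wb\<close> in its column (a north-west corner), the chord \<open>by\<close> has smaller slope than the
  chord \<open>aw\<close>; at a south-east corner the inequality is reversed. As slopes increase along the lower
  and decrease along the upper chain, no south-east corner lies beyond a north-west corner. Hence,
  for any prescribed size, rows and columns can be cut so that the top left block has no north-west
  corner and the bottom right block no south-east corner; these two blocks together have at most as
  many entries as there are points, and the other two blocks are treated recursively on half of the
  points each.
\<close>

section \<open>Corners in 0-1 matrices and linear bounds on the number of entries\<close>

text \<open>A matrix is the set of positions of its ones. First coordinates number the rows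
  downwards, second coordinates the columns rightwards, so \<open>(a, b)\<close> is the entry with
  one companion to its right and one below.\<close>

definition no_nw_corner :: "('a::linorder \<times> 'b::linorder) set \<Rightarrow> bool" where
  "no_nw_corner M \<longleftrightarrow>
     (\<forall>a w b y. a < w \<longrightarrow> b < y \<longrightarrow> (a, b) \<in> M \<longrightarrow> (a, y) \<in> M \<longrightarrow> (w, b) \<in> M \<longrightarrow> False)"

definition no_se_corner :: "('a::linorder \<times> 'b::linorder) set \<Rightarrow> bool" where
  "no_se_corner M \<longleftrightarrow>
     (\<forall>a w b y. w < a \<longrightarrow> y < b \<longrightarrow> (a, b) \<in> M \<longrightarrow> (a, y) \<in> M \<longrightarrow> (w, b) \<in> M \<longrightarrow> False)"

text \<open>The two corners may touch in a row \<open>w = w'\<close> or a column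
  \<open>y = y'\<close>: the maximality argument for the cut separates them only weakly.\<close>

definition no_nw_se_corners :: "('a::linorder \<times> 'b::linorder) set \<Rightarrow> bool" where
  "no_nw_se_corners M \<longleftrightarrow>
     (\<forall>a w w' a' b y y' b'. a < w \<longrightarrow> w \<le> w' \<longrightarrow> w' < a' \<longrightarrow> b < y \<longrightarrow> y \<le> y' \<longrightarrow> y' < b' \<longrightarrow>
        (a, b) \<in> M \<longrightarrow> (a, y) \<in> M \<longrightarrow> (w, b) \<in> M \<longrightarrow>
        (a', b') \<in> M \<longrightarrow> (a', y') \<in> M \<longrightarrow> (w', b') \<in> M \<longrightarrow> False)"

text \<open>The graph of \<open>f\<close> over \<open>X\<close> and the graph of \<open>g\<close>
  over \<open>Y\<close> together cover \<open>M\<close>.\<close>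

lemma card_le_if_determined_by_coordinate:
  assumes "finite X" "finite Y" "M \<subseteq> X \<times> Y"
    and det: "\<And>a b. (a, b) \<in> M \<Longrightarrow> f a = b \<or> g b = a"
  shows "card M \<le> card X + card Y"
proof -
  have "M \<subseteq> (\<lambda>a. (a, f a)) ` X \<union> (\<lambda>b. (g b, b)) ` Y"
    using assms(3) det by blast
  then have "card M \<le> card ((\<lambda>a. (a, f a)) ` X \<union> (\<lambda>b. (g b, b)) ` Y)"
    using assms by (intro card_mono) auto
  also have "\<dots> \<le> card X + card Y"
    using assms by (meson card_Un_le card_image_le add_mono order_trans)
  finally show ?thesis .
qed

lemma finite_row: "finite M \<Longrightarrow> finite {y. (a, y) \<in> M}"
  by (rule finite_subset[of _ "snd ` M"]) force+

lemma finite_column: "finite M \<Longrightarrow> finite {w. (w, b) \<in> M}"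
  by (rule finite_subset[of _ "fst ` M"]) force+

text \<open>An entry that is neither the last of its row nor the last of its column is a north-west
  corner. So each entry is determined by its row or by its column.\<close>

lemma card_no_nw_corner:
  assumes "finite X" "finite Y" "M \<subseteq> X \<times> Y" "no_nw_corner M"
  shows "card M \<le> card X + card Y"
proof (rule card_le_if_determined_by_coordinate[where
        f = "\<lambda>a. Max {y. (a, y) \<in> M}" and g = "\<lambda>b. Max {w. (w, b) \<in> M}"])
  have fin: "finite M" using assms finite_subset by blast
  fix a b assume ab: "(a, b) \<in> M"
  show "Max {y. (a, y) \<in> M} = b \<or> Max {w. (w, b) \<in> M} = a"
  proof (rule ccontr)
    assume neg: "\<not> ?thesis"
    obtain y where "(a, y) \<in> M" "b < y"
      using neg ab Max_in[OF finite_row[OF fin, of a]] Max_ge[OF finite_row[OF fin, of a], of b]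
      by force
    moreover obtain w where "(w, b) \<in> M" "a < w"
      using neg ab Max_in[OF finite_column[OF fin, of b]] Max_ge[OF finite_column[OF fin, of b], of a]
      by force
    ultimately show False using ab assms(4) unfolding no_nw_corner_def by blast
  qed
qed (use assms in auto)

lemma card_no_se_corner:
  assumes "finite X" "finite Y" "M \<subseteq> X \<times> Y" "no_se_corner M"
  shows "card M \<le> card X + card Y"
proof (rule card_le_if_determined_by_coordinate[where
        f = "\<lambda>a. Min {y. (a, y) \<in> M}" and g = "\<lambda>b. Min {w. (w, b) \<in> M}"])
  have fin: "finite M" using assms finite_subset by blast
  fix a b assume ab: "(a, b) \<in> M"
  show "Min {y. (a, y) \<in> M} = b \<or> Min {w. (w, b) \<in> M} = a"
  proof (rule ccontr)
    assume neg: "\<not> ?thesis"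
    obtain y where "(a, y) \<in> M" "y < b"
      using neg ab Min_in[OF finite_row[OF fin, of a]] Min_le[OF finite_row[OF fin, of a], of b]
      by force
    moreover obtain w where "(w, b) \<in> M" "w < a"
      using neg ab Min_in[OF finite_column[OF fin, of b]] Min_le[OF finite_column[OF fin, of b], of a]
      by force
    ultimately show False using ab assms(4) unfolding no_se_corner_def by blast
  qed
qed (use assms in auto)

text \<open>Serves to count the edges inside one chain. An entry that is neither the last of its row
  nor the first of its column is the middle \<open>(a', b)\<close> of a forbidden zigzag.\<close>

lemma card_increasing_pairs:
  fixes M :: "('a::linorder \<times> 'a) set"
  assumes "finite X" "M \<subseteq> X \<times> X"
    and zigzag: "\<And>a a' b b'. a < a' \<Longrightarrow> b < b' \<Longrightarrow> (a, b) \<in> M \<Longrightarrow> (a', b) \<in> M \<Longrightarrow> (a', b') \<in> M \<Longrightarrow> False"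
  shows "card M \<le> 2 * card X"
proof -
  have fin: "finite M" using assms finite_subset by blast
  have "card M \<le> card X + card X"
  proof (rule card_le_if_determined_by_coordinate[where
        f = "\<lambda>a. Max {y. (a, y) \<in> M}" and g = "\<lambda>b. Min {w. (w, b) \<in> M}"])
    fix a b assume ab: "(a, b) \<in> M"
    show "Max {y. (a, y) \<in> M} = b \<or> Min {w. (w, b) \<in> M} = a"
    proof (rule ccontr)
      assume neg: "\<not> ?thesis"
      obtain y where "(a, y) \<in> M" "b < y"
        using neg ab Max_in[OF finite_row[OF fin, of a]] Max_ge[OF finite_row[OF fin, of a], of b]
        by force
      moreover obtain w where "(w, b) \<in> M" "w < a"
        using neg ab Min_in[OF finite_column[OF fin, of b]] Min_le[OF finite_column[OF fin, of b], of a]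
        by force
      ultimately show False using ab zigzag by blast
    qed
  qed (use assms in auto)
  then show ?thesis by simp
qed

section \<open>Cutting rows and columns, and the recursive count\<close>

definition initial_part :: "'a::linorder set \<Rightarrow> 'a set \<Rightarrow> bool" where
  "initial_part T X \<longleftrightarrow> T \<subseteq> X \<and> (\<forall>t\<in>T. \<forall>x\<in>X - T. t < x)"

lemma initial_part_insert_Min:
  assumes "finite X" "initial_part T X" "T \<noteq> X"
  shows "initial_part (insert (Min (X - T)) T) X" "Min (X - T) \<in> X - T"
proof -
  have ne: "X - T \<noteq> {}" using assms unfolding initial_part_def by blast
  show m: "Min (X - T) \<in> X - T" using assms ne by (intro Min_in) auto
  show "initial_part (insert (Min (X - T)) T) X"
    unfolding initial_part_def
  proof (intro conjI ballI)
    show "insert (Min (X - T)) T \<subseteq> X" using assms(2) m unfolding initial_part_def by blast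
  next
    fix t x assume t: "t \<in> insert (Min (X - T)) T" and x: "x \<in> X - insert (Min (X - T)) T"
    have "Min (X - T) \<le> x" using x assms(1) by (intro Min_le) auto
    then have "Min (X - T) < x" using x by auto
    moreover have "t < x" if "t \<in> T" using that x assms(2) unfolding initial_part_def by blast
    ultimately show "t < x" using t by blast
  qed
qed

lemma initial_part_exists:
  assumes "finite X" "i \<le> card X"
  shows "\<exists>T. initial_part T X \<and> card T = i"
  using assms(2)
proof (induction i)
  case 0
  show ?case by (rule exI[of _ "{}"]) (simp add: initial_part_def)
next
  case (Suc i)
  then obtain T where T: "initial_part T X" "card T = i" by auto
  then have "T \<noteq> X" using Suc by auto
  note ins = initial_part_insert_Min[OF assms(1) T(1) this]
  have "finite T" using T(1) assms(1) finite_subset unfolding initial_part_def by blast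
  then have "card (insert (Min (X - T)) T) = Suc i" using ins(2) T(2) by simp
  then show ?case using ins(1) by blast
qed

text \<open>Among the cuts with the prescribed \<open>h\<close> and a top left block without
  north-west corner, one with as many rows in \<open>T\<close> as possible works. Here
  \<open>h\<close> is the number of rows plus columns of the top right block, which the recursion
  wants to halve.\<close>

lemma corner_free_split:
  assumes "finite X" "finite Y" "h \<le> card X + card Y" and M: "no_nw_se_corners M"
  shows "\<exists>T L. initial_part T X \<and> initial_part L Y \<and> card T + card (Y - L) = h
           \<and> no_nw_corner (M \<inter> T \<times> L) \<and> no_se_corner (M \<inter> (X - T) \<times> (Y - L))"
proof -
  define Q where "Q T L \<longleftrightarrow> initial_part T X \<and> initial_part L Y \<and> card T + card (Y - L) = h
           \<and> no_nw_corner (M \<inter> T \<times> L)" for T L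
  have sub: "card (Y - L) = card Y - card L" if "initial_part L Y" for L
    using that assms(2) by (meson card_Diff_subset finite_subset initial_part_def)
  \<comment> \<open>A cut with \<open>T\<close> or \<open>L\<close> empty has an empty top left
    block; whether \<open>h\<close> exceeds the number of columns decides which of the two is
    available.\<close>
  have ex: "\<exists>T L. Q T L"
  proof (cases "h \<le> card Y")
    case True
    obtain L where "initial_part L Y" "card L = card Y - h"
      using initial_part_exists[OF assms(2), of "card Y - h"] by auto
    then have "Q {} L" using True sub
      unfolding Q_def by (simp add: initial_part_def no_nw_corner_def)
    then show ?thesis by blast
  next
    case False
    have "h - card Y \<le> card X" using assms(3) by linarith
    then obtain T where "initial_part T X" "card T = h - card Y"
      using initial_part_exists[OF assms(1)] by blast
    then have "Q T {}" using False
      unfolding Q_def by (simp add: initial_part_def no_nw_corner_def)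
    then show ?thesis by blast
  qed
  have bound: "card T \<le> card X" if "Q T L" for T L
    using that assms(1) by (simp add: Q_def initial_part_def card_mono)
  obtain T0 L0 where "Q T0 L0" using ex by blast
  then have "\<exists>TL. case_prod Q TL \<and> (\<forall>TL'. case_prod Q TL' \<longrightarrow> card (fst TL') \<le> card (fst TL))"
    using bound
    by (intro ex_has_greatest_nat[of "case_prod Q" "(T0, L0)" "\<lambda>TL. card (fst TL)" "Suc (card X)"])
       (auto simp: less_Suc_eq_le)
  then obtain T L where Q: "Q T L" and mx: "\<And>T' L'. Q T' L' \<Longrightarrow> card T' \<le> card T"
    by auto
  have "no_se_corner (M \<inter> (X - T) \<times> (Y - L))"
  proof (cases "T = X \<or> L = Y")
    case True
    then show ?thesis by (auto simp: no_se_corner_def)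
  next
    case False
    have TL: "initial_part T X" "initial_part L Y" using Q by (auto simp: Q_def)
    let ?a = "Min (X - T)" and ?b = "Min (Y - L)"
    have insT: "initial_part (insert ?a T) X" "?a \<in> X - T"
      using initial_part_insert_Min[OF assms(1) TL(1)] False by auto
    have insL: "initial_part (insert ?b L) Y" "?b \<in> Y - L"
      using initial_part_insert_Min[OF assms(2) TL(2)] False by auto
    have fin: "finite T" "finite L"
      using TL assms finite_subset unfolding initial_part_def by blast+
    have cT: "card (insert ?a T) = Suc (card T)" using insT fin by simp
    have "card (insert ?b L) = Suc (card L)" using insL fin by simp
    moreover have "card (insert ?b L) \<le> card Y"
      using insL(1) assms(2) by (simp add: initial_part_def card_mono del: card_insert_disjoint)
    ultimately have "card (insert ?a T) + card (Y - insert ?b L) = h"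
      using cT sub[OF insL(1)] sub[OF TL(2)] Q[unfolded Q_def] by linarith
    \<comment> \<open>Moving the cut one row down and one column right preserves \<open>h\<close>,
      so by maximality the enlarged block must contain a north-west corner. That corner ends no
      later than \<open>?a\<close> and \<open>?b\<close>, whereas a south-east corner of the bottom
      right block starts no earlier.\<close>
    moreover have "\<not> Q (insert ?a T) (insert ?b L)"
      using mx cT by fastforce
    ultimately have "\<not> no_nw_corner (M \<inter> insert ?a T \<times> insert ?b L)"
      using insT insL by (simp add: Q_def)
    then obtain a w b y where nw: "a < w" "b < y" "(a, b) \<in> M" "(a, y) \<in> M" "(w, b) \<in> M"
      "w \<in> insert ?a T" "y \<in> insert ?b L"
      unfolding no_nw_corner_def by blast
    show ?thesis
      unfolding no_se_corner_def
    proof (intro allI impI)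
      fix a' w' b' y'
      assume se: "w' < a'" "y' < b'" "(a', b') \<in> M \<inter> (X - T) \<times> (Y - L)"
        "(a', y') \<in> M \<inter> (X - T) \<times> (Y - L)" "(w', b') \<in> M \<inter> (X - T) \<times> (Y - L)"
      have "?a \<le> w'" "?b \<le> y'" using se assms by (auto intro!: Min_le)
      moreover have "w \<le> ?a"
        using nw(6) TL(1) insT(2) unfolding initial_part_def by (metis insertE less_imp_le order_refl)
      moreover have "y \<le> ?b"
        using nw(7) TL(2) insL(2) unfolding initial_part_def by (metis insertE less_imp_le order_refl)
      ultimately have "w \<le> w'" "y \<le> y'" by auto
      then show False using nw se M unfolding no_nw_se_corners_def by blast
    qed
  qed
  then show ?thesis using Q unfolding Q_def by blast
qed

text \<open>Each level of the recursion costs at most \<open>card X + card Y\<close> for the two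
  diagonal blocks, and the off-diagonal blocks share out the rows and columns without overlap, so
  \<open>k\<close> halvings give the factor \<open>k\<close>.\<close>

lemma card_no_nw_se_corners:
  assumes "finite X" "finite Y" "M \<subseteq> X \<times> Y" "no_nw_se_corners M" "card X + card Y \<le> 2 ^ k"
  shows "card M \<le> k * (card X + card Y)"
  using assms
proof (induction k arbitrary: X Y M)
  case 0
  then have "card X + card Y \<le> 1" by simp
  then have "card X = 0 \<or> card Y = 0" by linarith
  then have "M = {}" using 0 by auto
  then show ?case by simp
next
  case (Suc k)
  let ?N = "card X + card Y"
  \<comment> \<open>Half of \<open>?N\<close>, rounded down for one off-diagonal block and up for
    the other, is at most \<open>2 ^ k\<close> in both cases.\<close>
  obtain T L where TL: "initial_part T X" "initial_part L Y" "card T + card (Y - L) = ?N div 2"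
    "no_nw_corner (M \<inter> T \<times> L)" "no_se_corner (M \<inter> (X - T) \<times> (Y - L))"
    using corner_free_split[OF Suc.prems(1,2), of "?N div 2" M] Suc.prems(4) by auto
  have sub: "T \<subseteq> X" "L \<subseteq> Y" using TL by (auto simp: initial_part_def)
  then have fin: "finite T" "finite L" "finite (X - T)" "finite (Y - L)"
    using Suc.prems finite_subset by blast+
  have cX: "card (X - T) + card T = card X" and cY: "card (Y - L) + card L = card Y"
    using sub fin Suc.prems by (simp_all add: card_Diff_subset card_mono)
  have mono: "no_nw_se_corners (M \<inter> Z)" for Z
    using Suc.prems(4) unfolding no_nw_se_corners_def by blast
  have 1: "card (M \<inter> T \<times> L) \<le> card T + card L"
    using TL fin by (intro card_no_nw_corner) auto
  have 2: "card (M \<inter> (X - T) \<times> (Y - L)) \<le> card (X - T) + card (Y - L)"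
    using TL fin by (intro card_no_se_corner) auto
  have 3: "card (M \<inter> T \<times> (Y - L)) \<le> k * (card T + card (Y - L))"
    using TL(3) Suc.prems(5) fin mono by (intro Suc.IH) auto
  have 4: "card (M \<inter> (X - T) \<times> L) \<le> k * (card (X - T) + card L)"
    using TL(3) Suc.prems(5) fin mono cX cY by (intro Suc.IH) auto
  have "M = M \<inter> T \<times> L \<union> M \<inter> (X - T) \<times> (Y - L) \<union> M \<inter> T \<times> (Y - L) \<union> M \<inter> (X - T) \<times> L"
    (is "M = ?A \<union> ?B \<union> ?C \<union> ?D")
    using Suc.prems(3) by auto
  then have "card M = card (?A \<union> ?B \<union> ?C \<union> ?D)" by (rule arg_cong)
  then have "card M \<le> card (M \<inter> T \<times> L) + card (M \<inter> (X - T) \<times> (Y - L))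
      + card (M \<inter> T \<times> (Y - L)) + card (M \<inter> (X - T) \<times> L)"
    using card_Un_le[of ?A ?B] card_Un_le[of "?A \<union> ?B" ?C] card_Un_le[of "?A \<union> ?B \<union> ?C" ?D]
    by linarith
  also have "\<dots> \<le> (card T + card L) + (card (X - T) + card (Y - L))
      + k * (card T + card (Y - L)) + k * (card (X - T) + card L)"
    using 1 2 3 4 by linarith
  also have "\<dots> = Suc k * ((card (X - T) + card T) + (card (Y - L) + card L))"
    by (simp add: algebra_simps)
  finally show ?case unfolding cX cY .
qed

section \<open>Turns, slopes and angles on the graph of a function\<close>

text \<open>Twice the signed area of the triangle on the graph points over \<open>p\<close>,
  \<open>q\<close>, \<open>s\<close>. For \<open>p < q < s\<close> it is negative exactly if the
  middle point lies above the chord.\<close>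

definition turn :: "(real \<Rightarrow> real) \<Rightarrow> real \<Rightarrow> real \<Rightarrow> real \<Rightarrow> real" where
  "turn Y p q s = (q - p) * (Y s - Y p) - (Y q - Y p) * (s - p)"

definition acute_at :: "(real \<Rightarrow> real) \<Rightarrow> real \<Rightarrow> real \<Rightarrow> real \<Rightarrow> bool" where
  "acute_at Y v u w \<longleftrightarrow> (u - v) * (w - v) + (Y u - Y v) * (Y w - Y v) > 0"

definition slope :: "(real \<Rightarrow> real) \<Rightarrow> real \<Rightarrow> real \<Rightarrow> real" where
  "slope Y p q = (Y q - Y p) / (q - p)"

lemma turn_rotate: "turn Y q s p = turn Y p q s"
  by (simp add: turn_def algebra_simps)

lemma turn_swap: "turn Y p s q = - turn Y p q s"
  by (simp add: turn_def algebra_simps)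

lemma turn_sign_iff_slope:
  assumes "p < q" "q < s"
  shows "turn Y p q s > 0 \<longleftrightarrow> slope Y p q < slope Y q s"
    "turn Y p q s < 0 \<longleftrightarrow> slope Y q s < slope Y p q"
proof -
  have "turn Y p q s = (slope Y q s - slope Y p q) * ((q - p) * (s - q))"
  proof -
    have "slope Y q s * (s - q) = Y s - Y q" "slope Y p q * (q - p) = Y q - Y p"
      using assms by (simp_all add: slope_def)
    moreover have "(slope Y q s - slope Y p q) * ((q - p) * (s - q)) =
        (slope Y q s * (s - q)) * (q - p) - (slope Y p q * (q - p)) * (s - q)"
      by (simp add: algebra_simps)
    ultimately have "(slope Y q s - slope Y p q) * ((q - p) * (s - q)) =
        (Y s - Y q) * (q - p) - (Y q - Y p) * (s - q)"
      by simp
    then show ?thesis by (simp add: turn_def algebra_simps)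
  qed
  moreover have "(q - p) * (s - q) > 0" using assms by simp
  ultimately show "turn Y p q s > 0 \<longleftrightarrow> slope Y p q < slope Y q s"
    "turn Y p q s < 0 \<longleftrightarrow> slope Y q s < slope Y p q"
    using assms by (auto simp: zero_less_mult_iff mult_less_0_iff)
qed

text \<open>As \<open>q\<close> lies between \<open>p\<close> and \<open>s\<close>, the positive
  inner product can be divided by \<open>(q - p) * (s - q)\<close>.\<close>

lemma acute_slopes:
  assumes "p < q" "q < s" "acute_at Y q p s"
  shows "slope Y p q * slope Y q s < -1"
proof -
  have "slope Y p q * slope Y q s * ((q - p) * (s - q)) = (Y q - Y p) * (Y s - Y q)"
    using assms by (simp add: slope_def)
  also have "\<dots> < (-1) * ((q - p) * (s - q))"
    using assms(3) by (simp add: acute_at_def algebra_simps)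
  finally show ?thesis using assms(1,2)
    by (metis mult_less_cancel_right_pos mult_pos_pos diff_gt_0_iff_gt)
qed

text \<open>Consecutive slopes have opposite signs, so \<open>s1\<close> and \<open>s3\<close> share
  a sign that \<open>s2\<close> does not have.\<close>

lemma monotone_slopes_not_acute:
  fixes s1 s2 s3 :: real
  assumes "s1 * s2 < -1" "s2 * s3 < -1" "(s1 < s2 \<and> s2 < s3) \<or> (s3 < s2 \<and> s2 < s1)"
  shows False
proof -
  have "s1 * s2 < 0" "s2 * s3 < 0" using assms by linarith+
  then show False using assms(3) by (auto simp: mult_less_0_iff)
qed

text \<open>Both \<open>p\<close> and \<open>q\<close> point to the right of \<open>v\<close>, with
  \<open>p\<close> forwards and \<open>q\<close> backwards, so the turn from \<open>q\<close> to
  \<open>p\<close> is counterclockwise. The proof expands the cross product in the orthogonal frame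
  given by \<open>v\<close>.\<close>

lemma cross_sign:
  fixes p1 p2 q1 q2 v1 v2 :: real
  assumes "p1 * v2 - p2 * v1 > 0" "q1 * v2 - q2 * v1 > 0"
    and "p1 * v1 + p2 * v2 > 0" "q1 * v1 + q2 * v2 < 0"
  shows "q1 * p2 - q2 * p1 > 0"
proof -
  have "(q1 * p2 - q2 * p1) * (v1\<^sup>2 + v2\<^sup>2) =
      (p1 * v1 + p2 * v2) * (q1 * v2 - q2 * v1) - (q1 * v1 + q2 * v2) * (p1 * v2 - p2 * v1)"
    by (simp add: algebra_simps power2_eq_square)
  also have "\<dots> > 0"
    using mult_pos_pos[OF assms(3,2)] mult_neg_pos[OF assms(4,1)] by linarith
  finally show ?thesis by (simp add: zero_less_mult_iff) (use sum_power2_ge_zero[of v1 v2] in linarith)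
qed

lemma slope_less_iff:
  assumes "a < a'" "b < b'"
  shows "slope Y b b' < slope Y a a' \<longleftrightarrow> (b' - b) * (Y a' - Y a) - (Y b' - Y b) * (a' - a) > 0"
  using assms by (simp add: slope_def field_simps)

section \<open>Points in convex position as two chains over the first coordinate\<close>

text \<open>Points are represented by their first coordinates in \<open>S\<close>, with
  \<open>Y\<close> giving the second ones. The assumption \<open>convex\<close> says that a point on
  or above one chord is strictly above every chord spanning it.\<close>

locale convex_function_graph =
  fixes S :: "real set" and Y :: "real \<Rightarrow> real" and adj :: "real \<Rightarrow> real \<Rightarrow> bool"
  assumes finite_S: "finite S"
    and adj_sym: "adj u v \<Longrightarrow> adj v u"
    and adj_acute: "adj u v \<Longrightarrow> adj u w \<Longrightarrow> v \<noteq> w \<Longrightarrow> acute_at Y v u w"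
    and convex: "\<lbrakk>p \<in> S; q \<in> S; s \<in> S; p' \<in> S; s' \<in> S; p < q; q < s; p' < q; q < s';
      turn Y p q s \<le> 0\<rbrakk> \<Longrightarrow> turn Y p' q s' < 0"
begin

text \<open>The leftmost and the rightmost point are spanned by no chord and thus fall into
  \<open>lower\<close>.\<close>

definition lower :: "real set" where
  "lower = {q \<in> S. \<forall>p\<in>S. \<forall>s\<in>S. p < q \<longrightarrow> q < s \<longrightarrow> turn Y p q s > 0}"

definition upper :: "real set" where
  "upper = S - lower"

lemma lowerD: "q \<in> lower \<Longrightarrow> p \<in> S \<Longrightarrow> s \<in> S \<Longrightarrow> p < q \<Longrightarrow> q < s \<Longrightarrow> turn Y p q s > 0"
  by (simp add: lower_def)

lemma upperD:
  assumes "q \<in> upper" "p \<in> S" "s \<in> S" "p < q" "q < s"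
  shows "turn Y p q s < 0"
proof -
  obtain p' s' where "p' \<in> S" "s' \<in> S" "p' < q" "q < s'" "turn Y p' q s' \<le> 0" "q \<in> S"
    using assms(1) by (auto simp: upper_def lower_def not_less)
  then show ?thesis using convex assms by blast
qed

lemma lower_S: "q \<in> lower \<Longrightarrow> q \<in> S" and upper_S: "q \<in> upper \<Longrightarrow> q \<in> S"
  by (auto simp: lower_def upper_def)

text \<open>The sign of the turn is read off at the middle one of the three points, whichever chain
  it belongs to.\<close>

lemma upper_above_chord:
  assumes "a \<in> lower" "a' \<in> lower" "b \<in> upper" "a < a'"
  shows "turn Y a a' b > 0"
proof -
  have "b \<noteq> a" "b \<noteq> a'" using assms by (auto simp: upper_def)
  then consider "b < a" | "a < b" "b < a'" | "a' < b" by linarith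
  then show ?thesis
  proof cases
    case 1
    then show ?thesis using lowerD[OF assms(1)] assms lower_S upper_S by (metis turn_rotate)
  next
    case 2
    then show ?thesis using upperD[OF assms(3)] assms lower_S turn_swap[of Y a a' b] by force
  next
    case 3
    then show ?thesis using lowerD[OF assms(2)] assms lower_S upper_S by blast
  qed
qed

lemma lower_below_chord:
  assumes "b \<in> upper" "b' \<in> upper" "a \<in> lower" "b < b'"
  shows "turn Y b b' a < 0"
proof -
  have "a \<noteq> b" "a \<noteq> b'" using assms by (auto simp: upper_def)
  then consider "a < b" | "b < a" "a < b'" | "b' < a" by linarith
  then show ?thesis
  proof cases
    case 1
    then show ?thesis using upperD[OF assms(1)] assms lower_S upper_S by (metis turn_rotate)
  next
    case 2
    then show ?thesis using lowerD[OF assms(3)] assms upper_S turn_swap[of Y b b' a] by force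
  next
    case 3
    then show ?thesis using upperD[OF assms(2)] assms lower_S upper_S by blast
  qed
qed

lemma chord_slopes_lower:
  assumes "a \<in> lower" "w \<in> lower" "w' \<in> lower" "a' \<in> lower" "a < w" "w \<le> w'" "w' < a'"
  shows "slope Y a w < slope Y w' a'"
proof -
  have st: "slope Y p q < slope Y q s" if "p \<in> lower" "q \<in> lower" "s \<in> lower" "p < q" "q < s" for p q s
    using that turn_sign_iff_slope(1)[of p q s Y] lowerD lower_S by blast
  show ?thesis
    using st[of a w w'] st[of w w' a'] st[of a w a'] assms by (cases "w = w'") auto
qed

lemma chord_slopes_upper:
  assumes "a \<in> upper" "w \<in> upper" "w' \<in> upper" "a' \<in> upper" "a < w" "w \<le> w'" "w' < a'"
  shows "slope Y w' a' < slope Y a w"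
proof -
  have st: "slope Y q s < slope Y p q" if "p \<in> upper" "q \<in> upper" "s \<in> upper" "p < q" "q < s" for p q s
    using that turn_sign_iff_slope(2)[of p q s Y] upperD upper_S by blast
  show ?thesis
    using st[of a w w'] st[of w w' a'] st[of a w a'] assms by (cases "w = w'") auto
qed

text \<open>Take \<open>v\<close> as the vector from \<open>a\<close> to \<open>b\<close> in
  \<open>cross_sign\<close>. The edges at \<open>b\<close> make the angle at \<open>a\<close> acute
  and the edges at \<open>a\<close> the one at \<open>b\<close>, which gives the inner products; the
  position of the chains gives the cross products.\<close>

lemma nw_corner_slopes:
  assumes "a \<in> lower" "w \<in> lower" "b \<in> upper" "y \<in> upper" "a < w" "b < y"
    and "adj a b" "adj a y" "adj w b"
  shows "slope Y b y < slope Y a w"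
proof -
  have "acute_at Y a b w" "acute_at Y b a y"
    using assms adj_acute[of b a w] adj_acute[of a b y] adj_sym by auto
  then have "(w - a) * (b - a) + (Y w - Y a) * (Y b - Y a) > 0"
     "(y - b) * (b - a) + (Y y - Y b) * (Y b - Y a) < 0"
    by (simp_all add: acute_at_def algebra_simps)
  moreover have "(w - a) * (Y b - Y a) - (Y w - Y a) * (b - a) > 0"
    using upper_above_chord[of a w b] assms by (simp add: turn_def)
  moreover have "(y - b) * (Y b - Y a) - (Y y - Y b) * (b - a) > 0"
    using lower_below_chord[of b y a] assms by (simp add: turn_def algebra_simps)
  ultimately show ?thesis
    using cross_sign slope_less_iff assms by blast
qed

text \<open>Here both chords run towards the corner edge, which flips the signs of the inner
  products and so exchanges the two chords in \<open>cross_sign\<close>.\<close>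

lemma se_corner_slopes:
  assumes "a \<in> lower" "w \<in> lower" "b \<in> upper" "y \<in> upper" "w < a" "y < b"
    and "adj a b" "adj a y" "adj w b"
  shows "slope Y w a < slope Y y b"
proof -
  have "acute_at Y a b w" "acute_at Y b a y"
    using assms adj_acute[of b a w] adj_acute[of a b y] adj_sym by auto
  then have "(a - w) * (b - a) + (Y a - Y w) * (Y b - Y a) < 0"
     "(b - y) * (b - a) + (Y b - Y y) * (Y b - Y a) > 0"
    by (simp_all add: acute_at_def algebra_simps)
  moreover have "(a - w) * (Y b - Y a) - (Y a - Y w) * (b - a) > 0"
    using upper_above_chord[of w a b] assms by (simp add: turn_def algebra_simps)
  moreover have "(b - y) * (Y b - Y a) - (Y b - Y y) * (b - a) > 0"
    using lower_below_chord[of y b a] assms by (simp add: turn_def algebra_simps)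
  ultimately show ?thesis
    using cross_sign slope_less_iff assms by blast
qed

lemma no_nw_se_corners_between_chains:
  "no_nw_se_corners {(a, b). a \<in> lower \<and> b \<in> upper \<and> adj a b}"
  unfolding no_nw_se_corners_def
proof (intro allI impI, clarsimp)
  fix a w w' a' b y y' b'
  assume *: "a < w" "w \<le> w'" "w' < a'" "b < y" "y \<le> y'" "y' < b'"
    "a \<in> lower" "w \<in> lower" "w' \<in> lower" "a' \<in> lower"
    "b \<in> upper" "y \<in> upper" "y' \<in> upper" "b' \<in> upper"
    "adj a b" "adj a y" "adj w b" "adj a' b'" "adj a' y'" "adj w' b'"
  have "slope Y b y < slope Y a w" using * nw_corner_slopes by blast
  also have "\<dots> < slope Y w' a'" using * chord_slopes_lower by blast
  also have "\<dots> < slope Y y' b'" using * se_corner_slopes by blast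
  also have "\<dots> < slope Y b y" using * chord_slopes_upper by blast
  finally show False .
qed

lemma card_edges_in_chain:
  assumes "C = lower \<or> C = upper"
  shows "card {(a, b). a \<in> C \<and> b \<in> C \<and> a < b \<and> adj a b} \<le> 2 * card C"
proof -
  let ?E = "{(a, b). a \<in> C \<and> b \<in> C \<and> a < b \<and> adj a b}"
  have "finite C" using assms finite_S by (auto simp: lower_def upper_def)
  moreover have False
    if *: "a < a'" "b < b'" "(a, b) \<in> ?E" "(a', b) \<in> ?E" "(a', b') \<in> ?E" for a a' b b'
  proof -
    \<comment> \<open>The order is \<open>a < a' < b < b'\<close>; the acute angles at
      \<open>a'\<close> and \<open>b\<close> concern three consecutive chords of one chain.\<close>
    from * have C: "a \<in> C" "a' \<in> C" "b \<in> C" "b' \<in> C" "a' < b" by auto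
    have "acute_at Y a' a b" "acute_at Y b a' b'"
      using * adj_acute[of b a' a] adj_acute[of a' b b'] adj_sym by (auto simp: acute_at_def mult.commute)
    then have "slope Y a a' * slope Y a' b < -1" "slope Y a' b * slope Y b b' < -1"
      using * C acute_slopes by blast+
    moreover have "(slope Y a a' < slope Y a' b \<and> slope Y a' b < slope Y b b') \<or>
        (slope Y b b' < slope Y a' b \<and> slope Y a' b < slope Y a a')"
      using assms C *(1,2) chord_slopes_lower[of a a' a' b] chord_slopes_lower[of a' b b b']
        chord_slopes_upper[of a a' a' b] chord_slopes_upper[of a' b b b'] by auto
    ultimately show False by (rule monotone_slopes_not_acute)
  qed
  ultimately show ?thesis
    by (intro card_increasing_pairs) auto
qed

lemma card_edges:
  assumes "card S \<le> 2 ^ k"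
  shows "card {(a, b). a \<in> S \<and> b \<in> S \<and> a < b \<and> adj a b} \<le> (k + 2) * card S"
proof -
  let ?E = "\<lambda>C. {(a, b). a \<in> C \<and> b \<in> C \<and> a < b \<and> adj a b}"
  let ?M = "{(a, b). a \<in> lower \<and> b \<in> upper \<and> adj a b}"
  let ?o = "\<lambda>(a, b). (min a b, max a b :: real)"
  have fin: "finite lower" "finite upper" using finite_S by (auto simp: lower_def upper_def)
  have cS: "card lower + card upper = card S"
    using finite_S fin
    by (subst card_Un_disjoint[symmetric])
       (auto simp: lower_def upper_def intro: arg_cong[where f = card])
  have M: "card ?M \<le> k * (card lower + card upper)"
    using fin assms cS no_nw_se_corners_between_chains
    by (intro card_no_nw_se_corners) auto
  have finM: "finite ?M" "finite (?E lower)" "finite (?E upper)"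
    using fin by (auto intro: finite_subset[of _ "(lower \<union> upper) \<times> (lower \<union> upper)"])
  \<comment> \<open>\<open>?M\<close> lists the lower end first, \<open>?E S\<close> the left end
    first; \<open>?o\<close> sorts the pair.\<close>
  have "?E S \<subseteq> ?o ` ?M \<union> ?E lower \<union> ?E upper"
  proof
    fix e assume "e \<in> ?E S"
    then obtain a b where *: "e = (a, b)" "a \<in> S" "b \<in> S" "a < b" "adj a b" by auto
    have o: "?o (a, b) = e" "?o (b, a) = e" using * by auto
    have "(a, b) \<in> ?M \<or> (b, a) \<in> ?M \<or> e \<in> ?E lower \<or> e \<in> ?E upper"
      using * adj_sym by (auto simp: upper_def)
    then show "e \<in> ?o ` ?M \<union> ?E lower \<union> ?E upper"
      using imageI[of "(a, b)" ?M ?o] imageI[of "(b, a)" ?M ?o] unfolding o by blast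
  qed
  then have "card (?E S) \<le> card (?o ` ?M \<union> ?E lower \<union> ?E upper)"
    using finM by (intro card_mono) auto
  also have "\<dots> \<le> card (?o ` ?M) + card (?E lower) + card (?E upper)"
    by (meson card_Un_le add_mono order_trans order_refl)
  also have "\<dots> \<le> k * (card lower + card upper) + 2 * card lower + 2 * card upper"
    using card_image_le[OF finM(1), of ?o] M
      card_edges_in_chain[OF disjI1[OF refl]] card_edges_in_chain[OF disjI2[OF refl]]
    by linarith
  also have "\<dots> = (k + 2) * card S" using cS by (simp add: algebra_simps flip: cS)
  finally show ?thesis .
qed

end

section \<open>From the plane to the graph of a function\<close>

lemma generic_direction:
  fixes P :: "point set"
  assumes "finite P"
  shows "\<exists>t. inj_on (\<lambda>p. p $ 1 + t * p $ 2) P"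
proof -
  \<comment> \<open>These are the values of \<open>t\<close> at which two points of different height
    collide. Pairs of equal height contribute \<open>0\<close> by division by zero, which keeps the
    set finite.\<close>
  let ?bad = "(\<lambda>(p, q). - (p $ 1 - q $ 1) / (p $ 2 - q $ 2)) ` (P \<times> P)"
  have "finite ?bad" using assms by simp
  then obtain t where t: "t \<notin> ?bad"
    using ex_new_if_finite infinite_UNIV_char_0 by blast
  have "p = q" if "p \<in> P" "q \<in> P" "p $ 1 + t * p $ 2 = q $ 1 + t * q $ 2" for p q
  proof (cases "p $ 2 = q $ 2")
    case True
    then show ?thesis using that by (simp add: vec_eq_iff forall_2)
  next
    case False
    then have "t = - (p $ 1 - q $ 1) / (p $ 2 - q $ 2)"
      using that(3) by (simp add: field_simps)
    then show ?thesis using t that by force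
  qed
  then show ?thesis by (auto intro: inj_onI)
qed

text \<open>Thales: \<open>v\<close> is strictly outside the disk exactly if its angle over
  \<open>uw\<close> is acute. Distance to the centre and radius are half the norms of the sum and
  the difference of \<open>u - v\<close> and \<open>w - v\<close>.\<close>

lemma notin_diam_disk_iff: "v \<notin> diam_disk u w \<longleftrightarrow> (u - v) \<bullet> (w - v) > 0"
proof -
  have "midpoint u w - v = (1/2) *\<^sub>R ((u - v) + (w - v))"
    by (simp add: midpoint_def vec_eq_iff field_simps)
  then have "dist (midpoint u w) v = norm ((u - v) + (w - v)) / 2"
    by (simp add: dist_norm)
  moreover have "dist u w = norm ((u - v) - (w - v))" by (simp add: dist_norm)
  ultimately have "v \<notin> diam_disk u w \<longleftrightarrow> norm ((u - v) - (w - v)) < norm ((u - v) + (w - v))"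
    by (simp add: diam_disk_def not_le)
  also have "\<dots> \<longleftrightarrow> ((u - v) - (w - v)) \<bullet> ((u - v) - (w - v)) < ((u - v) + (w - v)) \<bullet> ((u - v) + (w - v))"
    by (rule norm_lt)
  also have "\<dots> \<longleftrightarrow> (u - v) \<bullet> (w - v) > 0"
    by (simp only: inner_diff_left inner_diff_right inner_add_left inner_add_right inner_commute) linarith
  finally show ?thesis .
qed

lemma locally_gabriel_acute:
  assumes "locally_gabriel P E" "{u, v} \<in> E" "{u, w} \<in> E" "v \<noteq> w"
  shows "(u - v) \<bullet> (w - v) > 0"
proof -
  have "v \<noteq> u"
    using assms unfolding locally_gabriel_def geometric_graph_def by (fastforce simp: doubleton_eq_iff)
  then have "v \<notin> diam_disk u w"
    using assms unfolding locally_gabriel_def by blast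
  then show ?thesis by (simp add: notin_diam_disk_iff)
qed

text \<open>With \<open>ycoord\<close> this is a rotation scaled by the square root of
  \<open>1 + t * t\<close>; the scaling avoids roots and multiplies inner products by a positive
  factor.\<close>

definition xcoord :: "real \<Rightarrow> point \<Rightarrow> real" where
  "xcoord t p = p $ 1 + t * p $ 2"

definition ycoord :: "real \<Rightarrow> point \<Rightarrow> real" where
  "ycoord t p = p $ 2 - t * p $ 1"

lemma coord_linear:
  "xcoord t (u + v) = xcoord t u + xcoord t v" "ycoord t (u + v) = ycoord t u + ycoord t v"
  "xcoord t (u - v) = xcoord t u - xcoord t v" "ycoord t (u - v) = ycoord t u - ycoord t v"
  "xcoord t (c *\<^sub>R u) = c * xcoord t u" "ycoord t (c *\<^sub>R u) = c * ycoord t u"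
  by (simp_all add: xcoord_def ycoord_def algebra_simps)

lemma inner_coord:
  "(1 + t\<^sup>2) * (u \<bullet> v) = xcoord t u * xcoord t v + ycoord t u * ycoord t v"
  by (simp add: inner_vec_def sum_2 xcoord_def ycoord_def algebra_simps power2_eq_square)

lemma coord_eqI:
  assumes "xcoord t u = xcoord t v" "ycoord t u = ycoord t v"
  shows "u = v"
proof -
  have "(1 + t\<^sup>2) * ((u - v) \<bullet> (u - v)) = 0"
    using assms by (simp add: inner_coord coord_linear)
  moreover have "1 + t\<^sup>2 \<noteq> 0" using zero_le_power2[of t] by linarith
  ultimately show ?thesis by simp
qed

lemma point_on_chord:
  assumes "p \<in> H" "s \<in> H" "convex H" "xcoord t p < x" "x < xcoord t s"
  shows "\<exists>u\<in>H. xcoord t u = x \<and>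
    (xcoord t s - xcoord t p) * (ycoord t u - ycoord t p) = (ycoord t s - ycoord t p) * (x - xcoord t p)"
proof -
  define \<tau> where "\<tau> = (x - xcoord t p) / (xcoord t s - xcoord t p)"
  have \<tau>: "0 \<le> \<tau>" "\<tau> \<le> 1" "\<tau> * (xcoord t s - xcoord t p) = x - xcoord t p"
    using assms by (simp_all add: \<tau>_def)
  let ?u = "(1 - \<tau>) *\<^sub>R p + \<tau> *\<^sub>R s"
  have "?u \<in> H" using assms \<tau> by (intro convexD) auto
  moreover have "xcoord t ?u = x" using \<tau>(3) by (simp add: coord_linear algebra_simps)
  moreover have "ycoord t ?u - ycoord t p = \<tau> * (ycoord t s - ycoord t p)"
    by (simp add: coord_linear algebra_simps)
  then have "(xcoord t s - xcoord t p) * (ycoord t ?u - ycoord t p) =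
      (ycoord t s - ycoord t p) * (\<tau> * (xcoord t s - xcoord t p))" by simp
  ultimately show ?thesis using \<tau>(3) by metis
qed

text \<open>On the vertical line through \<open>q\<close>, the chord \<open>ps\<close> has a point
  \<open>u\<close> not above \<open>q\<close> and the chord \<open>p's'\<close> a point
  \<open>v\<close> not below it, so \<open>q\<close> is in the hull of the other points.\<close>

lemma convex_position_no_sandwich:
  assumes "convex_position P" "{p, q, s, p', s'} \<subseteq> P"
    and x: "xcoord t p < xcoord t q" "xcoord t q < xcoord t s"
      "xcoord t p' < xcoord t q" "xcoord t q < xcoord t s'"
    and above: "(xcoord t q - xcoord t p) * (ycoord t s - ycoord t p)
      \<le> (ycoord t q - ycoord t p) * (xcoord t s - xcoord t p)"
    and below: "(xcoord t q - xcoord t p') * (ycoord t s' - ycoord t p')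
      \<ge> (ycoord t q - ycoord t p') * (xcoord t s' - xcoord t p')"
  shows False
proof -
  let ?H = "convex hull (P - {q})"
  have mem: "p \<in> ?H" "s \<in> ?H" "p' \<in> ?H" "s' \<in> ?H"
    using assms(2) x by (auto intro!: hull_inc)
  obtain u where u: "u \<in> ?H" "xcoord t u = xcoord t q"
    "(xcoord t s - xcoord t p) * (ycoord t u - ycoord t p) =
      (ycoord t s - ycoord t p) * (xcoord t q - xcoord t p)"
    using point_on_chord[OF mem(1,2) convex_convex_hull x(1,2)] by blast
  obtain v where v: "v \<in> ?H" "xcoord t v = xcoord t q"
    "(xcoord t s' - xcoord t p') * (ycoord t v - ycoord t p') =
      (ycoord t s' - ycoord t p') * (xcoord t q - xcoord t p')"
    using point_on_chord[OF mem(3,4) convex_convex_hull x(3,4)] by blast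
  have "(xcoord t s - xcoord t p) * (ycoord t u - ycoord t p) \<le>
     (xcoord t s - xcoord t p) * (ycoord t q - ycoord t p)"
    using above u(3) by (simp add: mult.commute)
  then have yu: "ycoord t u \<le> ycoord t q" using x by simp
  have "(xcoord t s' - xcoord t p') * (ycoord t v - ycoord t p') \<ge>
     (xcoord t s' - xcoord t p') * (ycoord t q - ycoord t p')"
    using below v(3) by (simp add: mult.commute)
  then have "ycoord t q \<le> ycoord t v" using x by simp
  with yu have "ycoord t q \<in> closed_segment (ycoord t u) (ycoord t v)"
    by (simp add: closed_segment_eq_real_ivl)
  then obtain c where c: "0 \<le> c" "c \<le> 1" "ycoord t q = (1 - c) * ycoord t u + c * ycoord t v"
    by (auto simp: in_segment)
  have "q = (1 - c) *\<^sub>R u + c *\<^sub>R v"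
    by (rule coord_eqI[of t]) (use c u(2) v(2) in \<open>simp_all add: coord_linear algebra_simps\<close>)
  moreover have "(1 - c) *\<^sub>R u + c *\<^sub>R v \<in> ?H"
    using u(1) v(1) c by (intro convexD[OF convex_convex_hull]) auto
  ultimately show False using assms(1,2) unfolding convex_position_def by auto
qed

lemma card_locally_gabriel:
  assumes "finite P" "convex_position P" "locally_gabriel P E" "card P \<le> 2 ^ k"
  shows "card E \<le> (k + 2) * card P"
proof -
  obtain t where inj: "inj_on (xcoord t) P"
    using generic_direction[OF assms(1)] unfolding xcoord_def[abs_def] by blast
  define z where "z = the_inv_into P (xcoord t)"
  define S where "S = xcoord t ` P"
  \<comment> \<open>Membership in \<open>S\<close> is built in because \<open>z\<close> inverts
    \<open>xcoord t\<close> only there.\<close>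
  define adj where "adj = (\<lambda>a b. a \<in> S \<and> b \<in> S \<and> {z a, z b} \<in> E)"
  let ?Y = "\<lambda>a. ycoord t (z a)"
  have zP: "z a \<in> P" and xz: "xcoord t (z a) = a" if "a \<in> S" for a
    using that inj by (auto simp: z_def S_def the_inv_into_f_f)
  have zx: "z (xcoord t p) = p" if "p \<in> P" for p
    using that inj by (simp add: z_def the_inv_into_f_f)
  have pos: "1 + t\<^sup>2 > 0" using zero_le_power2[of t] by linarith
  interpret convex_function_graph S ?Y adj
  proof
    show "finite S" using assms(1) by (simp add: S_def)
    show "adj v u" if "adj u v" for u v using that by (simp add: adj_def insert_commute)
    show "acute_at ?Y v u w" if *: "adj u v" "adj u w" "v \<noteq> w" for u v w
    proof -
      have S: "u \<in> S" "v \<in> S" "w \<in> S" using * by (auto simp: adj_def)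
      then have "z v \<noteq> z w" using xz * by metis
      then have "(z u - z v) \<bullet> (z w - z v) > 0"
        using locally_gabriel_acute[OF assms(3)] * by (simp add: adj_def)
      then have "(1 + t\<^sup>2) * ((z u - z v) \<bullet> (z w - z v)) > 0" using pos by simp
      then show ?thesis using S by (simp add: inner_coord coord_linear xz acute_at_def)
    qed
    show "turn ?Y p' q s' < 0"
      if *: "p \<in> S" "q \<in> S" "s \<in> S" "p' \<in> S" "s' \<in> S" "p < q" "q < s" "p' < q" "q < s'"
        "turn ?Y p q s \<le> 0" for p q s p' s'
    proof (rule ccontr)
      assume "\<not> ?thesis"
      then show False
        using convex_position_no_sandwich[OF assms(2), of "z p" "z q" "z s" "z p'" "z s'" t] * zP
        by (simp add: xz turn_def)
    qed
  qed
  let ?D = "{(a, b). a \<in> S \<and> b \<in> S \<and> a < b \<and> adj a b}"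
  have "E \<subseteq> (\<lambda>(a, b). {z a, z b}) ` ?D"
  proof
    fix e assume e: "e \<in> E"
    then obtain p q where pq: "e = {p, q}" "p \<in> P" "q \<in> P" "p \<noteq> q"
      using assms(3) unfolding locally_gabriel_def geometric_graph_def by blast
    then have "xcoord t p \<noteq> xcoord t q" using inj by (auto dest: inj_onD)
    then consider "xcoord t p < xcoord t q" | "xcoord t q < xcoord t p" by linarith
    then show "e \<in> (\<lambda>(a, b). {z a, z b}) ` ?D"
    proof cases
      case 1
      then show ?thesis using e pq
        by (intro image_eqI[of _ _ "(xcoord t p, xcoord t q)"]) (auto simp: zx adj_def S_def)
    next
      case 2
      then show ?thesis using e pq
        by (intro image_eqI[of _ _ "(xcoord t q, xcoord t p)"]) (auto simp: zx adj_def S_def insert_commute)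
    qed
  qed
  moreover have finD: "finite ?D"
    using finite_S by (auto intro: finite_subset[of _ "S \<times> S"])
  ultimately have "card E \<le> card ?D"
    using surj_card_le by blast
  also have "card S = card P" using inj by (simp add: S_def card_image)
  then have "card ?D \<le> (k + 2) * card P" using card_edges[of k] assms(4) by simp
  finally show ?thesis .
qed

theorem theorem3:
  shows "\<exists>C::real. \<forall>(P::point set) E.
           finite P \<and> P \<noteq> {} \<and> convex_position P \<and> locally_gabriel P E \<longrightarrow>
           real (card E) \<le> 2 * real (card P) * log 2 (real (card P)) + C * real (card P)"
proof (intro exI allI impI)
  fix P :: "point set" and E
  assume *: "finite P \<and> P \<noteq> {} \<and> convex_position P \<and> locally_gabriel P E"
  let ?n = "card P"
  have n: "1 \<le> real ?n" using * by (simp add: Suc_leI card_gt_0_iff)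
  then have lg: "0 \<le> log 2 (real ?n)" by simp
  \<comment> \<open>Rounding up costs at most 1 in the exponent, and \<open>nat\<close> is harmless
    as the logarithm is nonnegative.\<close>
  define k where "k = nat \<lceil>log 2 (real ?n)\<rceil>"
  have k: "log 2 (real ?n) \<le> real k" "real k \<le> log 2 (real ?n) + 1"
    using lg unfolding k_def by linarith+
  then have "real ?n \<le> 2 ^ k"
    using n by (simp add: log_le_iff powr_realpow)
  then have "?n \<le> 2 ^ k" by (metis of_nat_le_iff of_nat_numeral of_nat_power)
  then have "card E \<le> (k + 2) * ?n" using * card_locally_gabriel by blast
  then have "real (card E) \<le> (real k + 2) * real ?n"
    by (metis of_nat_le_iff of_nat_mult of_nat_add of_nat_numeral)
  \<comment> \<open>\<open>k + 2\<close> is at most the logarithm plus 3, and the logarithm is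
    nonnegative; this yields the constant 3.\<close>
  also have "\<dots> \<le> (2 * log 2 (real ?n) + 3) * real ?n"
    using k lg by (intro mult_right_mono) auto
  also have "\<dots> = 2 * real ?n * log 2 (real ?n) + 3 * real ?n"
    by (simp add: algebra_simps)
  finally show "real (card E) \<le> 2 * real ?n * log 2 (real ?n) + 3 * real ?n" .
qed

end
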